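(* Let $n\ge1$ and let $b_1\ne b_2$ be words in $\Delta_n$ with $\Lambda_n(b_1)=(r_1,s_1)$ and $\Lambda_n(b_2)=(r_2,s_2)$. The two points of the plane which form a nondegenerate equilateral triangle with $P(b_1)$ and $P(b_2)$ have scaled integer coordinates $$Z_+(b_1,b_2)=(r_1+s_2-s_1,\ r_1-r_2+s_2),$$ $$Z_-(b_1,b_2)=(r_2-s_2+s_1,\ s_1+r_2-r_1).$$ Moreover, $$\kappa_n(b_1,b_2)=\#\bigl(\{Z_+(b_1,b_2),Z_-(b_1,b_2)\}\cap\Lambda_n(\Delta_n)\bigr).$$
   Context: $\Delta_n=\{i,j,k,e\}^n$ is the set of words $b=b_1b_2\cdots b_n$ of length $n$ in the four symbols $i,j,k,e$. Put $v(i)=(\cos 210^\circ,\sin 210^\circ)$, $v(j)=(\cos 90^\circ,\sin 90^\circ)$, $v(k)=(\cos 330^\circ,\sin 330^\circ)$, $v(e)=(0,0)$ in $\mathbb R^2$. Fix a real $d_1>0$ and put $d_r=d_1/2^{r-1}$. The centroid map $P:\Delta_n\to\mathbb R^2$ is $$P(b)=\sum_{r=1}^n \sigma_r(b)\,d_r\,v(b_r),\qquad \sigma_r(b)=(-1)^{\#\{s<r:\ b_s=e\}}.$$ With $\lambda(i)=(1,0)$, $\lambda(j)=(0,1)$, $\lambda(k)=(-1,-1)$, $\lambda(e)=(0,0)$, the scaled integer centroid-coordinate map is $$\Lambda_n(b)=\sum_{r=1}^n\sigma_r(b)\,2^{n-r}\lambda(b_r)\in\mathbb Z^2 .$$ A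 point $Q\in\mathbb R^2$ has scaled coordinates $(X,Y)$ if $\frac{2^{n-1}}{d_1}Q=X\,v(i)+Y\,v(j)$; in particular $P(b)$ has scaled coordinates $\Lambda_n(b)$. For distinct $b_1,b_2\in\Delta_n$, the completion number $\kappa_n(b_1,b_2)$ is the number of $b_3\in\Delta_n$ such that $P(b_1),P(b_2),P(b_3)$ are the vertices of a nondegenerate equilateral triangle. *)

theory Defs
  imports "HOL-Analysis.Analysis"
begin

datatype letter = Li | Lj | Lk | Le

definition words :: "nat \<Rightarrow> letter list set" where
  "words n = {b. length b = n}"

text \<open>Angles are in degrees in the source, hence the factor \<open>pi / 180\<close>.\<close>

fun v :: "letter \<Rightarrow> real^2" where
  "v Li = vector [cos (210 * pi / 180), sin (210 * pi / 180)]"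
| "v Lj = vector [cos (90 * pi / 180), sin (90 * pi / 180)]"
| "v Lk = vector [cos (330 * pi / 180), sin (330 * pi / 180)]"
| "v Le = vector [0, 0]"

fun lam :: "letter \<Rightarrow> int \<times> int" where
  "lam Li = (1, 0)"
| "lam Lj = (0, 1)"
| "lam Lk = (-1, -1)"
| "lam Le = (0, 0)"

text \<open>Positions in a word are numbered from 1, so the letter \<open>b\<^sub>r\<close> is \<open>b ! (r - 1)\<close>.\<close>

definition sgn_at :: "nat \<Rightarrow> letter list \<Rightarrow> int" where
  "sgn_at r b = (-1) ^ card {s. 1 \<le> s \<and> s < r \<and> b ! (s - 1) = Le}"

definition centroid :: "real \<Rightarrow> nat \<Rightarrow> letter list \<Rightarrow> real^2" where
  "centroid d1 n b =
     (\<Sum>r = 1..n. (of_int (sgn_at r b) * (d1 / 2 ^ (r - 1))) *\<^sub>R v (b ! (r - 1)))"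

definition Lam :: "nat \<Rightarrow> letter list \<Rightarrow> int \<times> int" where
  "Lam n b =
     (\<Sum>r = 1..n. (sgn_at r b * 2 ^ (n - r) * fst (lam (b ! (r - 1))),
                   sgn_at r b * 2 ^ (n - r) * snd (lam (b ! (r - 1)))))"

definition has_scaled_coords :: "real \<Rightarrow> nat \<Rightarrow> real^2 \<Rightarrow> real \<Rightarrow> real \<Rightarrow> bool" where
  "has_scaled_coords d1 n Q X Y \<longleftrightarrow>
     (2 ^ (n - 1) / d1) *\<^sub>R Q = X *\<^sub>R v Li + Y *\<^sub>R v Lj"

definition equilateral_triangle :: "real^2 \<Rightarrow> real^2 \<Rightarrow> real^2 \<Rightarrow> bool" where
  "equilateral_triangle A B C \<longleftrightarrow>
     \<not> collinear {A, B, C} \<and> dist A B = dist B C \<and> dist B C = dist C A"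

definition completion_number :: "real \<Rightarrow> nat \<Rightarrow> letter list \<Rightarrow> letter list \<Rightarrow> nat" where
  "completion_number d1 n b1 b2 =
     card {b3 \<in> words n.
       equilateral_triangle (centroid d1 n b1) (centroid d1 n b2) (centroid d1 n b3)}"

end

theory Submission
  imports Defs
begin

text \<open>
  Since \<open>v Li\<close> and \<open>v Lj\<close> are unit vectors at an angle of 120 degrees, the squared length of
  \<open>X v Li + Y v Lj\<close> is \<open>X\<^sup>2 - X Y + Y\<^sup>2\<close>, the norm form of the Eisenstein integers. In these
  coordinates a rotation by 60 degrees has integer entries: it sends \<open>(a, b)\<close> to \<open>(b, b - a)\<close>
  in one direction and to \<open>(a - b, a)\<close> in the other. Applied to the difference of two points, it
  gives the third vertices \<open>Z\<^sub>+\<close> and \<open>Z\<^sub>-\<close>; that there are no other ones follows by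
  intersecting the perpendicular bisector of the side with a circle around one of its ends
  (\<open>hex_equidistant_iff\<close>, \<open>equilateral_completions_hex\<close>). Because
  \<open>v Li + v Lj + v Lk = 0\<close>, the scaled coordinates of a centroid \<open>P(b)\<close> are \<open>\<Lambda>(b)\<close>
  (\<open>centroid_eq_hex_point\<close>).

  The other ingredient is that \<open>\<Lambda>\<close> is injective on words of a fixed length (\<open>inj_on_Lam\<close>).
  It ensures both that distinct words have distinct centroids, so that the side is not degenerate,
  and that counting completing words is the same as counting completing coordinates. Injectivity is
  proved by reading a word off its coordinates from the last letter backwards: the parities of the
  coordinates give the last letter, but stripping its contribution also requires the sign in front
  of it, which is determined by the sum of the coordinates modulo 3 (\<open>sgn_at_mod_3\<close>).
\<close>

section \<open>Words are determined by their coordinates\<close>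

lemma sgn_at_append:
  assumes "r \<le> Suc (length b)"
  shows "sgn_at r (b @ [c]) = sgn_at r b"
proof -
  have "{s. 1 \<le> s \<and> s < r \<and> (b @ [c]) ! (s - 1) = Le} = {s. 1 \<le> s \<and> s < r \<and> b ! (s - 1) = Le}"
    using assms by (auto simp: nth_append)
  then show ?thesis
    unfolding sgn_at_def by simp
qed

lemma sgn_at_snoc:
  "sgn_at (Suc (Suc (length b))) (b @ [c]) = (if c = Le then - 1 else 1) * sgn_at (Suc (length b)) b"
proof -
  let ?S = "{s. 1 \<le> s \<and> s < Suc (length b) \<and> b ! (s - 1) = Le}"
  have "{s. 1 \<le> s \<and> s < Suc (Suc (length b)) \<and> (b @ [c]) ! (s - 1) = Le}
      = (if c = Le then insert (Suc (length b)) ?S else ?S)"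
    by (auto simp: nth_append less_Suc_eq)
  moreover have "finite ?S"
    by simp
  ultimately show ?thesis
    unfolding sgn_at_def by simp
qed

lemma sgn_at_cases: "sgn_at r b = 1 \<or> sgn_at r b = - 1"
  unfolding sgn_at_def by (metis neg_one_even_power neg_one_odd_power)

lemma Lam_snoc:
  "Lam (Suc (length b)) (b @ [c]) =
     (2 * fst (Lam (length b) b) + sgn_at (Suc (length b)) b * fst (lam c),
      2 * snd (Lam (length b) b) + sgn_at (Suc (length b)) b * snd (lam c))"
proof -
  let ?n = "length b"
  have sum_snoc: "(\<Sum>r = 1..Suc ?n. sgn_at r (b @ [c]) * 2 ^ (Suc ?n - r) * g (lam ((b @ [c]) ! (r - 1))))
      = 2 * (\<Sum>r = 1..?n. sgn_at r b * 2 ^ (?n - r) * g (lam (b ! (r - 1))))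
        + sgn_at (Suc ?n) b * g (lam c)" for g :: "int \<times> int \<Rightarrow> int"
  proof -
    have "(\<Sum>r = 1..?n. sgn_at r (b @ [c]) * 2 ^ (Suc ?n - r) * g (lam ((b @ [c]) ! (r - 1))))
        = (\<Sum>r = 1..?n. 2 * (sgn_at r b * 2 ^ (?n - r) * g (lam (b ! (r - 1)))))"
      by (rule sum.cong) (auto simp: sgn_at_append nth_append Suc_diff_le)
    then show ?thesis
      by (simp add: sgn_at_append sum_distrib_left)
  qed
  show ?thesis
    unfolding Lam_def using sum_snoc[of fst] sum_snoc[of snd]
    by (simp add: prod_eq_iff fst_sum snd_sum)
qed

text \<open>The sign that a further letter would get can be read off the coordinates: it is congruent to
  \<open>(-1)\<^sup>n - (X + Y)\<close> modulo 3, and \<open>1\<close> and \<open>-1\<close> are different modulo 3. This works because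
  \<open>i\<close>, \<open>j\<close> and \<open>k\<close> all have coordinate sum 1 modulo 3. With \<open>\<sigma>\<close> the current sign and
  \<open>2 \<equiv> -1\<close>, appending one of them turns \<open>(-1)\<^sup>n - (X + Y)\<close> into its negative minus \<open>\<sigma>\<close>,
  that is \<open>-2\<sigma> \<equiv> \<sigma>\<close>; appending \<open>e\<close> merely negates it.\<close>

lemma sgn_at_mod_3:
  "3 dvd sgn_at (Suc (length b)) b - ((- 1) ^ length b - (fst (Lam (length b) b) + snd (Lam (length b) b)))"
proof (induction b rule: rev_induct)
  case Nil
  have "{s. 1 \<le> s \<and> s < Suc 0 \<and> ([] :: letter list) ! (s - 1) = Le} = {}"
    by auto
  then have "sgn_at (Suc 0) [] = 1"
    unfolding sgn_at_def by (simp only: card.empty power_0)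
  then show ?case
    by (simp add: Lam_def zero_prod_def)
next
  case (snoc c b)
  have len: "length (b @ [c]) = Suc (length b)"
    by simp
  show ?case
    unfolding len sgn_at_snoc Lam_snoc using snoc.IH
    by (cases c; simp; presburger)
qed

lemma lam_parity_inj:
  assumes "even (fst (lam c) - fst (lam c'))" "even (snd (lam c) - snd (lam c'))"
  shows "c = c'"
  using assms by (cases c; cases c') auto

text \<open>A word is recovered from the end: parity gives the last letter, \<open>sgn_at_mod_3\<close> gives the sign
  after the word and hence, the last letter being known, the sign before it; subtracting the
  contribution of the last letter leaves twice the coordinates of the shorter word.\<close>

lemma inj_on_Lam: "inj_on (Lam n) (words n)"
proof (induction n)
  case 0
  show ?case
    by (auto simp: inj_on_def words_def)
next
  case (Suc n)
  show ?case
  proof (rule inj_onI)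
    fix w w' assume w: "w \<in> words (Suc n)" "w' \<in> words (Suc n)" and eq: "Lam (Suc n) w = Lam (Suc n) w'"
    obtain b c b' c' where b: "w = b @ [c]" "w' = b' @ [c']" and len: "length b = n" "length b' = n"
      using w unfolding words_def by (auto simp: length_Suc_conv_rev)
    define \<sigma> \<sigma>' where "\<sigma> = sgn_at (Suc n) b" and "\<sigma>' = sgn_at (Suc n) b'"
    have X: "2 * fst (Lam n b) + \<sigma> * fst (lam c) = 2 * fst (Lam n b') + \<sigma>' * fst (lam c')"
      and Y: "2 * snd (Lam n b) + \<sigma> * snd (lam c) = 2 * snd (Lam n b') + \<sigma>' * snd (lam c')"
      using eq Lam_snoc[of b c] Lam_snoc[of b' c'] unfolding b len \<sigma>_def \<sigma>'_def by auto
    have \<sigma>: "\<sigma> = 1 \<or> \<sigma> = - 1" and \<sigma>': "\<sigma>' = 1 \<or> \<sigma>' = - 1"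
      unfolding \<sigma>_def \<sigma>'_def by (rule sgn_at_cases)+
    \<comment> \<open>Modulo 2 the signs and the doubled coordinates disappear.\<close>
    have "even (fst (lam c) - fst (lam c'))" "even (snd (lam c) - snd (lam c'))"
      using X Y \<sigma> \<sigma>' by (auto; presburger)+
    then have c: "c = c'"
      by (rule lam_parity_inj)
    have "3 dvd sgn_at (Suc (Suc n)) w - sgn_at (Suc (Suc n)) w'"
      using dvd_diff[OF sgn_at_mod_3[of w] sgn_at_mod_3[of w']] eq unfolding b by (simp add: len)
    then have "3 dvd (if c = Le then - 1 else 1) * (\<sigma> - \<sigma>')"
      using sgn_at_snoc[of b c] sgn_at_snoc[of b' c'] unfolding b c len \<sigma>_def \<sigma>'_def
      by (auto split: if_splits)
    then have "\<sigma> = \<sigma>'"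
      using \<sigma> \<sigma>' by (auto split: if_splits)
    then have "Lam n b = Lam n b'"
      using X Y c by (simp add: prod_eq_iff)
    then have "b = b'"
      using Suc.IH len unfolding inj_on_def words_def by auto
    then show "w = w'"
      using b c by simp
  qed
qed

section \<open>Equilateral triangles in the hexagonal basis\<close>

(* Otherwise the basis vectors v Li and v Lj would be replaced by cosines and sines. *)
declare v.simps [simp del]

definition hex_point :: "real \<Rightarrow> real \<Rightarrow> real \<Rightarrow> real^2" where
  "hex_point a X Y = a *\<^sub>R (X *\<^sub>R v Li + Y *\<^sub>R v Lj)"

lemma v_exact:
  "v Li = vector [- (sqrt 3 / 2), - (1 / 2)]" "v Lj = vector [0, 1]" "v Lk = vector [sqrt 3 / 2, - (1 / 2)]"
proof -
  have *: "cos (210 * pi / 180) = - (sqrt 3 / 2)" "sin (210 * pi / 180) = - (1 / 2)"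
    using cos_periodic_pi[of "pi / 6"] sin_periodic_pi[of "pi / 6"]
    by (simp_all add: cos_30 sin_30 field_simps)
  have **: "cos (330 * pi / 180) = sqrt 3 / 2" "sin (330 * pi / 180) = - (1 / 2)"
    using cos_2pi_minus[of "pi / 6"] sin_2pi_minus[of "pi / 6"]
    by (simp_all add: cos_30 sin_30 field_simps)
  have ***: "cos (90 * pi / 180) = 0" "sin (90 * pi / 180) = 1"
    using cos_pi_half sin_pi_half by (simp_all add: field_simps)
  show "v Li = vector [- (sqrt 3 / 2), - (1 / 2)]" "v Lj = vector [0, 1]" "v Lk = vector [sqrt 3 / 2, - (1 / 2)]"
    unfolding v.simps * ** *** by (rule refl)+
qed

text \<open>The case of \<open>k\<close> is the relation \<open>v Li + v Lj + v Lk = 0\<close>.\<close>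

lemma v_lam: "v c = of_int (fst (lam c)) *\<^sub>R v Li + of_int (snd (lam c)) *\<^sub>R v Lj"
  by (cases c) (simp_all add: v_exact v.simps(4) vec_eq_iff forall_2)

lemma hex_point_nth:
  "hex_point a X Y $ 1 = - (a * X * sqrt 3 / 2)" "hex_point a X Y $ 2 = a * (Y - X / 2)"
  by (simp_all add: hex_point_def v_exact field_simps)

lemma ex_hex_point:
  assumes "a \<noteq> 0"
  obtains X Y where "Q = hex_point a X Y"
proof
  show "Q = hex_point a (- 2 * Q $ 1 / (sqrt 3 * a)) (Q $ 2 / a - Q $ 1 / (sqrt 3 * a))"
    using assms by (simp add: vec_eq_iff forall_2 hex_point_nth field_simps)
qed

lemma hex_point_eq_iff:
  assumes "a \<noteq> 0"
  shows "hex_point a X Y = hex_point a X' Y' \<longleftrightarrow> X = X' \<and> Y = Y'"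
  using assms by (auto simp: vec_eq_iff forall_2 hex_point_nth)

lemma dist_hex_point:
  "(dist (hex_point a X Y) (hex_point a X' Y'))\<^sup>2
     = a\<^sup>2 * ((X - X')\<^sup>2 - (X - X') * (Y - Y') + (Y - Y')\<^sup>2)"
proof -
  define p q where "p = X - X'" and "q = Y - Y'"
  have "hex_point a X Y $ 1 - hex_point a X' Y' $ 1 = - (sqrt 3 * (a * p / 2))"
    "hex_point a X Y $ 2 - hex_point a X' Y' $ 2 = a * (q - p / 2)"
    by (simp_all add: hex_point_nth p_def q_def field_simps)
  then have "(dist (hex_point a X Y) (hex_point a X' Y'))\<^sup>2 = (sqrt 3 * (a * p / 2))\<^sup>2 + (a * (q - p / 2))\<^sup>2"
    by (simp add: dist_vec_def L2_set_def sum_2 dist_real_def)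
  also have "\<dots> = 3 * (a * p / 2)\<^sup>2 + (a * (q - p / 2))\<^sup>2"
    by (simp add: power_mult_distrib power_divide)
  also have "\<dots> = a\<^sup>2 * (p\<^sup>2 - p * q + q\<^sup>2)"
    by (simp add: power2_eq_square field_simps)
  finally show ?thesis
    unfolding p_def q_def .
qed

text \<open>The algebraic core, with one vertex at the origin and another at \<open>(a, b)\<close>. The second
  equation, whose quadratic terms cancel, is that of the perpendicular bisector of that side, the
  line through the two claimed solutions; with these at \<open>t = 0\<close> and \<open>t = 1\<close>, the remaining
  equation says that the product of \<open>t (t - 1)\<close> with a nonzero norm vanishes.\<close>

lemma hex_equidistant_iff:
  fixes a b x y :: real
  assumes "a \<noteq> 0 \<or> b \<noteq> 0"
  shows "(a\<^sup>2 - a * b + b\<^sup>2 = (x - a)\<^sup>2 - (x - a) * (y - b) + (y - b)\<^sup>2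
           \<and> (x - a)\<^sup>2 - (x - a) * (y - b) + (y - b)\<^sup>2 = x\<^sup>2 - x * y + y\<^sup>2)
         \<longleftrightarrow> x = b \<and> y = b - a \<or> x = a - b \<and> y = a"
    (is "?L \<longleftrightarrow> ?R")
proof
  assume ?L
  then have lin: "(2 * a - b) * (x - b) + (2 * b - a) * (y - (b - a)) = 0"
    and norm: "x\<^sup>2 - x * y + y\<^sup>2 = a\<^sup>2 - a * b + b\<^sup>2"
    by (auto simp: power2_eq_square algebra_simps)
  obtain t where t: "x = b + t * (a - 2 * b)" "y = b - a + t * (2 * a - b)"
  proof (cases "2 * a - b = 0")
    case True
    then have "2 * b - a \<noteq> 0"
      using assms by auto
    then show ?thesis
      using that[of "(x - b) / (a - 2 * b)"] lin True by auto
  next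
    case False
    have "x - b = (y - (b - a)) / (2 * a - b) * (a - 2 * b)"
      using False lin by (simp add: field_simps)
    then show ?thesis
      using that[of "(y - (b - a)) / (2 * a - b)"] False by auto
  qed
  \<comment> \<open>The displacement \<open>(a - 2b, 2a - b)\<close> has norm \<open>3 (a\<^sup>2 - ab + b\<^sup>2)\<close>, as twice the height of the triangle.\<close>
  have "3 * (t * (t - 1)) * (a\<^sup>2 - a * b + b\<^sup>2) = 0"
    using norm unfolding t by (simp add: power2_eq_square algebra_simps)
  moreover have "a\<^sup>2 - a * b + b\<^sup>2 \<noteq> 0"
  proof -
    have "a\<^sup>2 - a * b + b\<^sup>2 = (a\<^sup>2 + b\<^sup>2 + (a - b)\<^sup>2) / 2"
      by (simp add: power2_eq_square field_simps)
    moreover have "0 < a\<^sup>2 + b\<^sup>2"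
      using assms by (simp add: sum_power2_gt_zero_iff)
    then have "0 < a\<^sup>2 + b\<^sup>2 + (a - b)\<^sup>2"
      by (rule add_pos_nonneg) simp
    ultimately show ?thesis
      by simp
  qed
  ultimately have "t = 0 \<or> t = 1"
    by auto
  then show ?R
    using t by auto
next
  assume ?R
  then show ?L
    by (auto simp: power2_eq_square algebra_simps)
qed

text \<open>Three equidistant points with two of them distinct cannot be collinear: \<open>C - A = c (B - A)\<close>
  would force both \<open>\<bar>c\<bar> = 1\<close> and \<open>\<bar>c - 1\<bar> = 1\<close>. Squared distances are used since they are polynomials in
  the coordinates.\<close>

lemma equilateral_triangle_iff_dist:
  assumes "A \<noteq> B"
  shows "equilateral_triangle A B C \<longleftrightarrow> (dist A B)\<^sup>2 = (dist B C)\<^sup>2 \<and> (dist B C)\<^sup>2 = (dist A C)\<^sup>2"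
proof -
  have "\<not> collinear {A, B, C}" if eq: "dist A B = dist B C" "dist B C = dist C A"
  proof
    assume "collinear {A, B, C}"
    then have "collinear {0, B - A, C - A}"
      using collinear_3[of B A C] by (simp add: insert_commute)
    moreover have "B - A \<noteq> 0" "C - A \<noteq> 0"
      using assms eq by auto
    ultimately obtain c where c: "C - A = c *\<^sub>R (B - A)"
      unfolding collinear_lemma by blast
    have "C - B = (c - 1) *\<^sub>R (B - A)"
      using c by (simp add: algebra_simps)
    then have "norm (C - B) = \<bar>c - 1\<bar> * norm (B - A)" "norm (C - A) = \<bar>c\<bar> * norm (B - A)"
      using c by simp_all
    moreover have "norm (C - B) = norm (B - A)" "norm (C - A) = norm (B - A)"
      using eq by (simp_all add: dist_norm norm_minus_commute)
    ultimately have "\<bar>c - 1\<bar> = 1" "\<bar>c\<bar> = 1"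
      using \<open>B - A \<noteq> 0\<close> by auto
    then show False
      by linarith
  qed
  then show ?thesis
    unfolding equilateral_triangle_def by (auto simp: dist_commute)
qed

proposition equilateral_completions_hex:
  assumes "a \<noteq> 0" and "X1 \<noteq> X2 \<or> Y1 \<noteq> Y2"
  shows "{Q. equilateral_triangle (hex_point a X1 Y1) (hex_point a X2 Y2) Q}
         = {hex_point a (X1 + Y2 - Y1) (X1 - X2 + Y2), hex_point a (X2 - Y2 + Y1) (Y1 + X2 - X1)}"
proof -
  have "equilateral_triangle (hex_point a X1 Y1) (hex_point a X2 Y2) (hex_point a X Y) \<longleftrightarrow>
        X = X1 + Y2 - Y1 \<and> Y = X1 - X2 + Y2 \<or> X = X2 - Y2 + Y1 \<and> Y = Y1 + X2 - X1" for X Y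
  proof -
    have N: "(dist (hex_point a X1 Y1) (hex_point a X2 Y2))\<^sup>2
        = a\<^sup>2 * ((X2 - X1)\<^sup>2 - (X2 - X1) * (Y2 - Y1) + (Y2 - Y1)\<^sup>2)"
      "(dist (hex_point a X2 Y2) (hex_point a X Y))\<^sup>2
        = a\<^sup>2 * ((X - X1 - (X2 - X1))\<^sup>2 - (X - X1 - (X2 - X1)) * (Y - Y1 - (Y2 - Y1)) + (Y - Y1 - (Y2 - Y1))\<^sup>2)"
      "(dist (hex_point a X1 Y1) (hex_point a X Y))\<^sup>2
        = a\<^sup>2 * ((X - X1)\<^sup>2 - (X - X1) * (Y - Y1) + (Y - Y1)\<^sup>2)"
      unfolding dist_hex_point by (simp_all add: power2_eq_square algebra_simps)
    have ne: "hex_point a X1 Y1 \<noteq> hex_point a X2 Y2"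
      using assms by (simp add: hex_point_eq_iff)
    have "X2 - X1 \<noteq> 0 \<or> Y2 - Y1 \<noteq> 0"
      using assms by auto
    note equidistant = hex_equidistant_iff[OF this, of "X - X1" "Y - Y1"]
    have "equilateral_triangle (hex_point a X1 Y1) (hex_point a X2 Y2) (hex_point a X Y) \<longleftrightarrow>
        X - X1 = Y2 - Y1 \<and> Y - Y1 = Y2 - Y1 - (X2 - X1) \<or>
        X - X1 = X2 - X1 - (Y2 - Y1) \<and> Y - Y1 = X2 - X1"
      unfolding equilateral_triangle_iff_dist[OF ne] N equidistant[symmetric]
      using assms(1) by simp
    then show ?thesis
      by auto
  qed
  then have "equilateral_triangle (hex_point a X1 Y1) (hex_point a X2 Y2) Q \<longleftrightarrow>
      Q = hex_point a (X1 + Y2 - Y1) (X1 - X2 + Y2) \<or> Q = hex_point a (X2 - Y2 + Y1) (Y1 + X2 - X1)" for Q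
    using ex_hex_point[OF \<open>a \<noteq> 0\<close>, of Q] hex_point_eq_iff[OF \<open>a \<noteq> 0\<close>] by metis
  then show ?thesis
    by blast
qed

section \<open>Counting completions\<close>

lemma has_scaled_coords_iff:
  assumes "d1 \<noteq> 0"
  shows "has_scaled_coords d1 n Q X Y \<longleftrightarrow> Q = hex_point (d1 / 2 ^ (n - 1)) X Y"
proof -
  define a where "a = d1 / 2 ^ (n - 1)"
  have "a \<noteq> 0" "2 ^ (n - 1) / d1 = inverse a"
    using assms by (simp_all add: a_def)
  moreover have "inverse a *\<^sub>R Q = w \<longleftrightarrow> Q = a *\<^sub>R w" for w
  proof
    assume "inverse a *\<^sub>R Q = w"
    then have "a *\<^sub>R w = a *\<^sub>R inverse a *\<^sub>R Q"
      by simp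
    then show "Q = a *\<^sub>R w"
      using \<open>a \<noteq> 0\<close> by simp
  qed (use \<open>a \<noteq> 0\<close> in simp)
  ultimately show ?thesis
    unfolding has_scaled_coords_def hex_point_def a_def[symmetric] by simp
qed

lemma centroid_eq_hex_point:
  "centroid d1 n b = hex_point (d1 / 2 ^ (n - 1)) (of_int (fst (Lam n b))) (of_int (snd (Lam n b)))"
proof -
  have "(of_int (sgn_at r b) * (d1 / 2 ^ (r - 1))) *\<^sub>R v (b ! (r - 1)) =
      (d1 / 2 ^ (n - 1)) *\<^sub>R
        (of_int (sgn_at r b * 2 ^ (n - r) * fst (lam (b ! (r - 1)))) *\<^sub>R v Li
         + of_int (sgn_at r b * 2 ^ (n - r) * snd (lam (b ! (r - 1)))) *\<^sub>R v Lj)"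
    if "r \<in> {1..n}" for r
  proof -
    have "n - 1 = (n - r) + (r - 1)"
      using that by auto
    then have "d1 / 2 ^ (r - 1) = d1 / 2 ^ (n - 1) * 2 ^ (n - r)"
      by (simp only: power_add) simp
    then show ?thesis
      by (subst v_lam) (simp add: scaleR_add_right ac_simps)
  qed
  then show ?thesis
    unfolding centroid_def Lam_def hex_point_def
    by (simp add: fst_sum snd_sum scaleR_sum_left sum.distrib scaleR_sum_right scaleR_add_right)
qed

theorem proposition3p2:
  fixes d1 :: real and n :: nat and b1 b2 :: "letter list" and r1 s1 r2 s2 :: int
  assumes "d1 > 0" and "n \<ge> 1"
    and "b1 \<in> words n" and "b2 \<in> words n" and "b1 \<noteq> b2"
    and "Lam n b1 = (r1, s1)" and "Lam n b2 = (r2, s2)"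
  shows "(\<exists>Qp Qm. Qp \<noteq> Qm \<and>
            {Q. equilateral_triangle (centroid d1 n b1) (centroid d1 n b2) Q} = {Qp, Qm} \<and>
            has_scaled_coords d1 n Qp (of_int (r1 + s2 - s1)) (of_int (r1 - r2 + s2)) \<and>
            has_scaled_coords d1 n Qm (of_int (r2 - s2 + s1)) (of_int (s1 + r2 - r1)))
       \<and> completion_number d1 n b1 b2 =
           card ({(r1 + s2 - s1, r1 - r2 + s2), (r2 - s2 + s1, s1 + r2 - r1)}
                 \<inter> Lam n ` words n)"
proof -
  define a where "a = d1 / 2 ^ (n - 1)"
  have a: "a \<noteq> 0"
    using assms(1) by (simp add: a_def)
  define Z where "Z = {(r1 + s2 - s1, r1 - r2 + s2), (r2 - s2 + s1, s1 + r2 - r1)}"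
  define Qp where "Qp = hex_point a (of_int (r1 + s2 - s1)) (of_int (r1 - r2 + s2))"
  define Qm where "Qm = hex_point a (of_int (r2 - s2 + s1)) (of_int (s1 + r2 - r1))"
  have ne: "r1 \<noteq> r2 \<or> s1 \<noteq> s2"
    using inj_on_Lam[of n] assms(3-7) unfolding inj_on_def by auto
  have eq: "{Q. equilateral_triangle (centroid d1 n b1) (centroid d1 n b2) Q} = {Qp, Qm}"
    using equilateral_completions_hex[OF a, of "of_int r1" "of_int r2" "of_int s1" "of_int s2"] ne assms(6,7)
    by (simp add: centroid_eq_hex_point Qp_def Qm_def a_def)
  have "r1 + s2 - s1 \<noteq> r2 - s2 + s1 \<or> r1 - r2 + s2 \<noteq> s1 + r2 - r1"
    using ne by presburger
  then have "Qp \<noteq> Qm"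
    unfolding Qp_def Qm_def hex_point_eq_iff[OF a] of_int_eq_iff by blast
  moreover have "has_scaled_coords d1 n Qp (of_int (r1 + s2 - s1)) (of_int (r1 - r2 + s2))"
    "has_scaled_coords d1 n Qm (of_int (r2 - s2 + s1)) (of_int (s1 + r2 - r1))"
    using assms(1) by (simp_all add: has_scaled_coords_iff Qp_def Qm_def a_def)
  moreover have "completion_number d1 n b1 b2 = card (Z \<inter> Lam n ` words n)"
  proof -
    have "equilateral_triangle (centroid d1 n b1) (centroid d1 n b2) (centroid d1 n b) \<longleftrightarrow> Lam n b \<in> Z" for b
    proof -
      have "equilateral_triangle (centroid d1 n b1) (centroid d1 n b2) (centroid d1 n b)
          \<longleftrightarrow> centroid d1 n b \<in> {Qp, Qm}"
        using eq by blast
      also have "\<dots> \<longleftrightarrow> Lam n b \<in> Z"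
        unfolding centroid_eq_hex_point a_def[symmetric] Qp_def Qm_def Z_def
          insert_iff hex_point_eq_iff[OF a] of_int_eq_iff
        by (auto simp: prod_eq_iff)
      finally show ?thesis .
    qed
    then have "completion_number d1 n b1 b2 = card {b \<in> words n. Lam n b \<in> Z}"
      unfolding completion_number_def by simp
    also have "\<dots> = card (Lam n ` {b \<in> words n. Lam n b \<in> Z})"
      by (rule card_image[symmetric]) (rule inj_on_subset[OF inj_on_Lam], blast)
    also have "Lam n ` {b \<in> words n. Lam n b \<in> Z} = Z \<inter> Lam n ` words n"
      by blast
    finally show ?thesis .
  qed
  ultimately show ?thesis
    using eq unfolding Z_def by blast
qed

end
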